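(* Any Kirby-Paris Hydra is eventually slain, no matter the strategy; that is, the rewrite relation $\to_{\mathit{KP}}$ on Kirby-Paris Hydras is terminating (there is no infinite sequence $h_0\to_{\mathit{KP}}h_1\to_{\mathit{KP}}h_2\to_{\mathit{KP}}\cdots$ of Kirby-Paris Hydras).
   Context: A Kirby-Paris Hydra is a finite rooted unordered tree with nodes labeled from $S=\{0,\dagger\}$, where the label $\dagger$ labels only the root. A tree with root label $f$ and immediate subtrees $t_1,\ldots,t_n$ ($n\ge0$) is written $f(t_1,\ldots,t_n)$, and $f$ if $n=0$; the order of the arguments is irrelevant. The relation $\to_{\mathit{KP}}$ is the rewrite relation (applicable at any subtree of a Hydra) given by the following rule schemas, where $\vec t,\vec t_1,\vec t_2$ are arbitrary finite (possibly empty) sequences of trees: (KP$_1$) $\dagger(\vec t,0)\to\dagger(\vec t)$; (KP$_2$) $f(\vec t_1,0(\vec t_2,0))\to f(\vec t_1,\underbrace{0(\vec t_2),\ldots,0(\vec t_2)}_{k\text{ times}})$ for any $f\in S$ and any $k\in\mathbb{N}$ (including $k=0$), where $k$ can be chosen freely at each step. *)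

theory Defs
  imports "HOL-Library.Multiset"
begin

datatype label = Zero | Dagger

text \<open>Finite rooted unordered labelled trees: since the order of the immediate subtrees is
  irrelevant, they form a finite multiset.\<close>

datatype (labels: 'a) tree = Node (root: 'a) (children: "'a tree multiset")

text \<open>\<^const>\<open>Dagger\<close> may occur at the root only. The root itself may carry either label.\<close>

definition hydra :: "label tree \<Rightarrow> bool" where
  "hydra h \<longleftrightarrow> (\<forall>t \<in># children h. Dagger \<notin> labels t)"

inductive KP :: "label tree \<Rightarrow> label tree \<Rightarrow> bool" (infix "\<rightarrow>\<^sub>K\<^sub>P" 50) where
  KP1: "Node Dagger (ts + {#Node Zero {#}#}) \<rightarrow>\<^sub>K\<^sub>P Node Dagger ts"
| KP2: "Node f (ts1 + {#Node Zero (ts2 + {#Node Zero {#}#})#})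
          \<rightarrow>\<^sub>K\<^sub>P Node f (ts1 + replicate_mset k (Node Zero ts2))"
| KP_subtree: "s \<rightarrow>\<^sub>K\<^sub>P t \<Longrightarrow> Node f (ts + {#s#}) \<rightarrow>\<^sub>K\<^sub>P Node f (ts + {#t#})"

end

theory Submission
  imports Defs
begin

text \<open>Removing one child and inserting any number of smaller children makes a tree smaller. Every
  Kirby-Paris step is of this form: in \<open>KP2\<close> the child \<open>0(ts2, 0)\<close> is replaced by copies of the
  smaller tree \<open>0(ts2)\<close>. The order is well-founded by structural induction on trees, since the
  multiset extension of the order restricted to its accessible part is well-founded. The labels
  play no role.\<close>

inductive tree_less :: "'a tree \<Rightarrow> 'a tree \<Rightarrow> bool" where
  replace_child: "(\<And>b. b \<in># K \<Longrightarrow> tree_less b a) \<Longrightarrow>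
    tree_less (Node f (M + K)) (Node f (add_mset a M))"

text \<open>Elements outside the accessible part have no predecessors in this relation; on the
  others, accessibility induction applies.\<close>

lemma wf_accp_part: "wf {(y, x). R y x \<and> Wellfounded.accp R x}"
proof (rule wfUNIVI)
  fix P x
  assume step: "\<forall>x. (\<forall>y. (y, x) \<in> {(y, x). R y x \<and> Wellfounded.accp R x} \<longrightarrow> P y) \<longrightarrow> P x"
  have "P x" if "Wellfounded.accp R x"
    using that by (induction rule: accp.induct) (use step in blast)
  then show "P x"
    using step by blast
qed

text \<open>Induction along \<open>mult1\<close> on the multiset of children: a tree below
  \<open>Node f M\<close> keeps the label \<open>f\<close>, and its children arise from
  \<open>M\<close> by one such step.\<close>

lemma accp_tree_less_Node:
  assumes "\<And>a. a \<in># M \<Longrightarrow> Wellfounded.accp tree_less a"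
  shows "Wellfounded.accp tree_less (Node f M)"
proof -
  let ?r = "{(y, x). tree_less y x \<and> Wellfounded.accp tree_less x}"
  have "wf (mult1 ?r)"
    by (intro wf_mult1 wf_accp_part)
  then show ?thesis
    using assms
  proof (induction M rule: wf_induct_rule)
    case (less M)
    show ?case
    proof (rule accpI)
      fix t
      assume "tree_less t (Node f M)"
      then obtain K a N where t: "t = Node f (N + K)" and M: "M = add_mset a N"
        and K: "\<And>b. b \<in># K \<Longrightarrow> tree_less b a"
        by (cases rule: tree_less.cases) auto
      have acc_a: "Wellfounded.accp tree_less a"
        using less.prems M by simp
      then have "(N + K, M) \<in> mult1 ?r"
        unfolding mult1_def using K M by blast
      \<comment> \<open>The assumption on the children survives the step, since the elements of
        \<open>K\<close> lie below the accessible \<open>a\<close>.\<close>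
      moreover have "Wellfounded.accp tree_less b" if "b \<in># N + K" for b
        using that less.prems M K acc_a by (auto intro: accp_downward)
      ultimately show "Wellfounded.accp tree_less t"
        unfolding t by (rule less.IH)
    qed
  qed
qed

lemma accp_tree_less: "Wellfounded.accp tree_less t"
  by (induction t) (rule accp_tree_less_Node)

lemma wfp_tree_less: "wfp tree_less"
  by (intro accp_wfpI allI accp_tree_less)

lemma KP_imp_tree_less: "s \<rightarrow>\<^sub>K\<^sub>P t \<Longrightarrow> tree_less t s"
proof (induction rule: KP.induct)
  case (KP1 ts)
  then show ?case
    using replace_child[of "{#}" "Node Zero {#}" Dagger ts] by simp
next
  case (KP2 f ts1 ts2 k)
  \<comment> \<open>Deleting a leaf is the instance of \<open>replace_child\<close> with
    \<open>K\<close> empty.\<close>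
  have "tree_less (Node Zero ts2) (Node Zero (add_mset (Node Zero {#}) ts2))"
    using replace_child[of "{#}" "Node Zero {#}" Zero ts2] by simp
  then have "tree_less b (Node Zero (ts2 + {#Node Zero {#}#}))"
    if "b \<in># replicate_mset k (Node Zero ts2)" for b
    using that by (simp split: if_splits)
  then have "tree_less (Node f (ts1 + replicate_mset k (Node Zero ts2)))
      (Node f (add_mset (Node Zero (ts2 + {#Node Zero {#}#})) ts1))"
    by (rule replace_child)
  then show ?case
    by simp
next
  case (KP_subtree s t f ts)
  then show ?case
    \<comment> \<open>Rewriting inside a child replaces it by a single smaller tree.\<close>
    using replace_child[of "{#t#}" s f ts] by simp
qed

theorem theorem6p4:
  "\<not> (\<exists>h :: nat \<Rightarrow> label tree. (\<forall>i. hydra (h i)) \<and> (\<forall>i. h i \<rightarrow>\<^sub>K\<^sub>P h (Suc i)))"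
  using wfp_tree_less KP_imp_tree_less
  unfolding wfp_def wf_iff_no_infinite_down_chain by blast

end
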